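(* For every integer $n \ge 4$, $|\mathfrak{D}^4_{2n}(1234)| = 0$.
   Context: A permutation $\pi$ of $[N]=\{1,\dots,N\}$ is written as $\pi(1)\pi(2)\cdots\pi(N)$. A Dumont permutation of the fourth kind (Dumont-4 permutation) of size $2n$ is a permutation $\pi$ of $[2n]$ in which all deficiencies are even values at even positions: for all $1\le i\le 2n$, if $\pi(i)<i$ then both $i$ and $\pi(i)$ are even. The set of these is $\mathfrak{D}^4_{2n}$. A permutation $\pi$ of $[N]$ contains a pattern $\tau\in S_k$ if there are indices $i_1<\dots<i_k$ such that for all $a,b$, $\pi(i_a)<\pi(i_b)$ if and only if $\tau(a)<\tau(b)$; otherwise $\pi$ avoids $\tau$. $\mathfrak{D}^4_{2n}(\tau)$ denotes the set of permutations in $\mathfrak{D}^4_{2n}$ avoiding $\tau$. *)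

theory Defs
  imports "HOL-Combinatorics.Permutations"
begin

text \<open>A permutation of \<open>[N]\<close> is a function with \<open>\<pi> permutes {1..N}\<close>, so it is
  the identity outside \<open>{1..N}\<close> and there are finitely many of them.\<close>

text \<open>The permutation with one-line notation \<open>w\<close>. Positions count from 1, list
  indices from 0.\<close>

definition one_line :: "nat list \<Rightarrow> nat \<Rightarrow> nat" where
  "one_line w i = (if i \<in> {1..length w} then w ! (i - 1) else i)"

definition dumont4 :: "nat \<Rightarrow> (nat \<Rightarrow> nat) set" where
  "dumont4 n = {\<pi>. \<pi> permutes {1..2 * n} \<and>
     (\<forall>i\<in>{1..2 * n}. \<pi> i < i \<longrightarrow> even i \<and> even (\<pi> i))}"

text \<open>The map \<open>f\<close> sends \<open>a\<close> to the index \<open>i\<^sub>a\<close>.\<close>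

definition contains_pattern ::
    "nat \<Rightarrow> (nat \<Rightarrow> nat) \<Rightarrow> nat \<Rightarrow> (nat \<Rightarrow> nat) \<Rightarrow> bool" where
  "contains_pattern N \<pi> k \<tau> \<longleftrightarrow>
     (\<exists>f. f ` {1..k} \<subseteq> {1..N} \<and> strict_mono_on {1..k} f \<and>
       (\<forall>a\<in>{1..k}. \<forall>b\<in>{1..k}. \<pi> (f a) < \<pi> (f b) \<longleftrightarrow> \<tau> a < \<tau> b))"

definition dumont4_avoiding :: "nat \<Rightarrow> nat \<Rightarrow> (nat \<Rightarrow> nat) \<Rightarrow> (nat \<Rightarrow> nat) set" where
  "dumont4_avoiding n k \<tau> = {\<pi> \<in> dumont4 n. \<not> contains_pattern (2 * n) \<pi> k \<tau>}"

end

theory Submission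
  imports Defs
begin

text \<open>
  In a Dumont permutation of the fourth kind an odd position carries a value at least as large as
  itself, and an odd value sits at a position at most as large as itself. So the value 1 is at
  position 1, the value 3 is at position 2 or 3, and position \<open>2n - 1\<close> carries \<open>2n - 1\<close> or \<open>2n\<close>:
  the values 1 and 3 begin an increasing sequence before position 4, and position \<open>2n - 1\<close> can end
  it. For \<open>n \<ge> 4\<close> the positions 4, 5 and 6 all lie before \<open>2n - 1\<close>. A value among them cannot be
  1, 3 or \<open>\<pi> (2n - 1)\<close>, and it lies strictly between 3 and \<open>\<pi> (2n - 1)\<close> unless it is 2 or \<open>2n\<close>.
  Three positions cannot share two values, so one of them completes an occurrence of 1234.
\<close>

lemma contains_1234I:
  assumes "1 \<le> i" "i < j" "j < k" "k < l" "l \<le> N"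
    and "\<pi> i < \<pi> j" "\<pi> j < \<pi> k" "\<pi> k < \<pi> l"
  shows "contains_pattern N \<pi> 4 (one_line [1, 2, 3, 4])"
proof -
  have four: "{1..4} = {1, 2, 3, 4::nat}"
    by auto
  let ?f = "one_line [i, j, k, l]"
  have f: "?f 1 = i" "?f 2 = j" "?f 3 = k" "?f 4 = l"
    by (simp_all add: one_line_def numeral_eq_Suc)
  have id: "one_line [1, 2, 3, 4] a = a" if "a \<in> {1, 2, 3, 4}" for a
    using that by (auto simp: one_line_def numeral_eq_Suc)
  have "?f ` {1..4} \<subseteq> {1..N}"
    unfolding four using assms(1-5) by (simp add: f f(1)[simplified])
  moreover have "strict_mono_on {1..4} ?f"
    unfolding four strict_mono_on_def using assms(2-4) by (auto simp: f f(1)[simplified])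
  moreover have "\<pi> (?f a) < \<pi> (?f b) \<longleftrightarrow> one_line [1, 2, 3, 4] a < one_line [1, 2, 3, 4] b"
    if "a \<in> {1..4}" "b \<in> {1..4}" for a b
  proof -
    have "one_line [1, 2, 3, 4] a = a" "one_line [1, 2, 3, 4] b = b"
      using that unfolding four by (auto intro!: id simp del: One_nat_def)
    then show ?thesis
      using that assms(6-8) unfolding four by (auto simp: f f(1)[simplified])
  qed
  ultimately show ?thesis
    unfolding contains_pattern_def by blast
qed

lemma dumont4_odd_position_le_value:
  assumes "\<pi> \<in> dumont4 n" "i \<in> {1..2 * n}" "odd i"
  shows "i \<le> \<pi> i"
  using assms unfolding dumont4_def by (auto simp: not_less[symmetric])

lemma dumont4_odd_value_position:
  assumes "\<pi> \<in> dumont4 n" "v \<in> {1..2 * n}" "odd v"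
  obtains p where "1 \<le> p" "p \<le> v" "\<pi> p = v"
proof -
  have perm: "\<pi> permutes {1..2 * n}"
    using assms(1) by (simp add: dumont4_def)
  then obtain p where p: "p \<in> {1..2 * n}" "\<pi> p = v"
    using assms(2) permutes_image[OF perm] by (metis imageE)
  have "\<not> v < p"
    using assms(1,3) p unfolding dumont4_def by auto
  then show thesis
    using p that by auto
qed

lemma dumont4_contains_1234:
  assumes \<pi>: "\<pi> \<in> dumont4 n" and n: "n \<ge> 4"
  shows "contains_pattern (2 * n) \<pi> 4 (one_line [1, 2, 3, 4])"
proof -
  have perm: "\<pi> permutes {1..2 * n}"
    using \<pi> by (simp add: dumont4_def)
  have inj: "\<pi> a = \<pi> b \<longleftrightarrow> a = b" for a b
    using permutes_inj[OF perm] by (auto dest: injD)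
  have range: "1 \<le> \<pi> a \<and> \<pi> a \<le> 2 * n" if "1 \<le> a" "a \<le> 2 * n" for a
    using permutes_in_image[OF perm, of a] that by simp
  let ?m = "2 * n - 1"
  have first: "\<pi> 1 = 1"
    using n by (auto intro: dumont4_odd_value_position[OF \<pi>, of 1])
  obtain p where p: "1 \<le> p" "p \<le> 3" "\<pi> p = 3"
    using n by (auto intro: dumont4_odd_value_position[OF \<pi>, of 3])
  have "p \<noteq> 1"
    using first p(3) by auto
  have last: "?m \<le> \<pi> ?m"
    using n by (intro dumont4_odd_position_le_value[OF \<pi>]) auto
  have "\<pi> 4 \<noteq> \<pi> 5" "\<pi> 4 \<noteq> \<pi> 6" "\<pi> 5 \<noteq> \<pi> 6"
    by (simp_all add: inj)
  \<comment> \<open>three distinct values, of which at most two are 2 and \<open>2n\<close>\<close>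
  then obtain j where j: "j \<in> {4, 5, 6}" "\<pi> j \<noteq> 2" "\<pi> j \<noteq> 2 * n"
    by (metis insertCI)
  have "\<pi> j \<noteq> \<pi> 1" "\<pi> j \<noteq> \<pi> p" "\<pi> j \<noteq> \<pi> ?m"
    using j(1) p(2) n by (auto simp: inj)
  \<comment> \<open>if \<open>\<pi> ?m = 2n - 1\<close>, excluding \<open>2n\<close> from \<open>\<pi> j\<close> is what puts \<open>\<pi> j\<close> below it\<close>
  moreover have "1 \<le> \<pi> j" "\<pi> j \<le> 2 * n"
    using range[of j] j(1) n by auto
  ultimately have "3 < \<pi> j" "\<pi> j < \<pi> ?m"
    using first p(3) j(2,3) last by linarith+
  then show ?thesis
    using first p \<open>p \<noteq> 1\<close> j(1) n by (intro contains_1234I[of 1 p j ?m]) auto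
qed

theorem theorem3p1:
  fixes n :: nat
  assumes "n \<ge> 4"
  shows "card (dumont4_avoiding n 4 (one_line [1, 2, 3, 4])) = 0"
proof -
  have "dumont4_avoiding n 4 (one_line [1, 2, 3, 4]) = {}"
    using dumont4_contains_1234[OF _ assms] by (auto simp: dumont4_avoiding_def)
  then show ?thesis
    by simp
qed

end
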